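(* Let $\lambda_0\in\mathbb R$ be such that $M(\lambda_0)=s\,\mathbb I$, where $s\in\{-1,1\}$. Then $$\lim_{\lambda\to\lambda_0}\Gamma(M(\lambda))=2\,\frac{\sqrt{I_2(\lambda_0)\,I_3(\lambda_0)-I_1(\lambda_0)^2}}{I_2(\lambda_0)+I_3(\lambda_0)}>0,$$ where the limit $\lambda\to\lambda_0$ is taken over complex $\lambda\neq\lambda_0$.
   Context: Setting: $m\ge0$, $a>0$, and $q:\mathbb R\to\mathbb R$ is locally integrable and $a$-periodic. Pauli matrices: $\sigma_2=\begin{pmatrix}0&-i\\i&0\end{pmatrix}$, $\sigma_3=\begin{pmatrix}1&0\\0&-1\end{pmatrix}$; $\mathbb I$ is the $2\times2$ unit matrix; $|w|=\sqrt{|w_1|^2+|w_2|^2}$ for $w\in\mathbb C^2$. For $\lambda\in\mathbb C$, $\Phi(\cdot,\lambda)$ is the $2\times2$ matrix solution of $-i\sigma_2\Phi'+(m\sigma_3+q)\Phi=\lambda\Phi$ on $\mathbb R$, $\Phi(0,\lambda)=\mathbb I$; its columns are denoted $u(\cdot,\lambda)$ and $v(\cdot,\lambda)$. The monodromy matrix is $M(\lambda)=\Phi(a,\lambda)$ (an entire function of $\lambda$, of determinant 1). Set $$I_1(\lambda)=\int_0^a(u_1v_1+u_2v_2)(x,\lambda)\,dx,\quad I_2(\lambda)=\int_0^a(v_1^2+v_2^2)(x,\lambda)\,dx,\quad I_3(\lambda)=\int_0^a(u_1^2+u_2^2)(x,\lambda)\,dx.$$ For a matrix $A\in\mathbb C^{2\times2}$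 with two distinct eigenvalues, $\Gamma(A)=\dfrac{|\det(w_+,w_-)|}{|w_+|\,|w_-|}\in(0,1]$, where $w_\pm\in\mathbb C^2\setminus\{0\}$ are eigenvectors of $A$ for the two different eigenvalues (independent of the choice of eigenvectors). $M(\lambda)$ has two distinct eigenvalues if and only if $\operatorname{Tr}M(\lambda)\notin\{-2,2\}$, which holds for all $\lambda\ne\lambda_0$ sufficiently close to $\lambda_0$. *)

theory Defs
  imports "HOL-Analysis.Analysis"
begin

definition sigma2 :: "complex^2^2" where
  "sigma2 = vector [vector [0, - \<i>], vector [\<i>, 0]]"

definition sigma3 :: "complex^2^2" where
  "sigma3 = vector [vector [1, 0], vector [0, - 1]]"

definition locally_integrable :: "(real \<Rightarrow> real) \<Rightarrow> bool" where
  "locally_integrable q \<longleftrightarrow> (\<forall>c d. q absolutely_integrable_on {c..d})"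

text \<open>Absolute continuity in the usual epsilon-delta sense. A set \<open>D\<close> with
  \<open>D division_of \<Union>D\<close> is a finite family of nonempty compact intervals with pairwise
  disjoint interiors. (The constant \<open>absolutely_continuous\<close> of the library is a relation
  between measures.)\<close>

definition abs_continuous_on :: "real set \<Rightarrow> (real \<Rightarrow> 'a::real_normed_vector) \<Rightarrow> bool" where
  "abs_continuous_on S f \<longleftrightarrow>
     (\<forall>e>0. \<exists>d>0. \<forall>D. D division_of \<Union>D \<and> \<Union>D \<subseteq> S \<and> (\<Sum>K\<in>D. Sup K - Inf K) < d \<longrightarrow>
        (\<Sum>K\<in>D. norm (f (Sup K) - f (Inf K))) < e)"

definition locally_abs_continuous :: "(real \<Rightarrow> 'a::real_normed_vector) \<Rightarrow> bool" where
  "locally_abs_continuous f \<longleftrightarrow> (\<forall>c d. abs_continuous_on {c..d} f)"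

text \<open>Since \<open>q\<close> is only locally integrable, solutions of
  \<open>-i \<sigma>\<^sub>2 Y' + (m \<sigma>\<^sub>3 + q) Y = lam Y\<close> are understood in the Caratheodory sense: locally
  absolutely continuous, with the equation holding almost everywhere. The matrix \<open>mat c\<close> is
  \<open>c\<close> times the unit matrix, so \<open>mat c ** A\<close> is the scalar multiple of \<open>A\<close> by \<open>c\<close>.\<close>

definition dirac_matrix_solution ::
    "real \<Rightarrow> (real \<Rightarrow> real) \<Rightarrow> complex \<Rightarrow> (real \<Rightarrow> complex^2^2) \<Rightarrow> bool" where
  "dirac_matrix_solution m q lam Y \<longleftrightarrow>
     locally_abs_continuous Y \<and>
     (AE x in lebesgue. \<exists>Y'. (Y has_vector_derivative Y') (at x) \<and>
        mat (- \<i>) ** sigma2 ** Y' + (mat (of_real m) ** sigma3 + mat (of_real (q x))) ** Y x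
          = mat lam ** Y x)"

definition monodromy :: "real \<Rightarrow> (real \<Rightarrow> complex \<Rightarrow> complex^2^2) \<Rightarrow> complex \<Rightarrow> complex^2^2" where
  "monodromy a \<Phi> lam = \<Phi> a lam"

definition I1 :: "real \<Rightarrow> (real \<Rightarrow> complex \<Rightarrow> complex^2^2) \<Rightarrow> complex \<Rightarrow> complex" where
  "I1 a \<Phi> lam = integral {0..a} (\<lambda>x. let u = column 1 (\<Phi> x lam); v = column 2 (\<Phi> x lam)
                                 in u $ 1 * v $ 1 + u $ 2 * v $ 2)"

definition I2 :: "real \<Rightarrow> (real \<Rightarrow> complex \<Rightarrow> complex^2^2) \<Rightarrow> complex \<Rightarrow> complex" where
  "I2 a \<Phi> lam = integral {0..a} (\<lambda>x. let v = column 2 (\<Phi> x lam) in (v $ 1)\<^sup>2 + (v $ 2)\<^sup>2)"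

definition I3 :: "real \<Rightarrow> (real \<Rightarrow> complex \<Rightarrow> complex^2^2) \<Rightarrow> complex \<Rightarrow> complex" where
  "I3 a \<Phi> lam = integral {0..a} (\<lambda>x. let u = column 1 (\<Phi> x lam) in (u $ 1)\<^sup>2 + (u $ 2)\<^sup>2)"

definition is_eigenvector :: "complex^2^2 \<Rightarrow> complex \<Rightarrow> complex^2 \<Rightarrow> bool" where
  "is_eigenvector A \<mu> w \<longleftrightarrow> w \<noteq> 0 \<and> A *v w = \<mu> *s w"

text \<open>The value is unspecified unless \<open>A\<close> has two distinct eigenvalues; in that case it does not
  depend on the eigenvectors. \<open>transpose (vector [w, z])\<close> is the matrix with columns \<open>w\<close>, \<open>z\<close>.\<close>

definition Gam :: "complex^2^2 \<Rightarrow> real" where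
  "Gam A = (THE g. \<exists>\<mu> \<nu> w z. \<mu> \<noteq> \<nu> \<and> is_eigenvector A \<mu> w \<and> is_eigenvector A \<nu> z \<and>
              g = cmod (det (transpose (vector [w, z]))) / (norm w * norm z))"

end

theory Submission
  imports Defs
begin

text \<open>The Wronskian of solutions \<open>y\<close>, \<open>z\<close> for the parameters \<open>\<lambda>\<close>, \<open>\<mu>\<close> has derivative
  \<open>(\<lambda> - \<mu>) (y\<^sub>1 z\<^sub>1 + y\<^sub>2 z\<^sub>2)\<close> almost everywhere. Comparing the columns \<open>u\<close>, \<open>v\<close> at \<open>\<lambda>\<^sub>0\<close> with
  those at \<open>\<lambda>\<close> gives the exact formula \<open>M(\<lambda>) = s I + s (\<lambda> - \<lambda>\<^sub>0) N(\<lambda>)\<close>, where the entries of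
  \<open>N(\<lambda>)\<close> are integrals of products of these columns, and \<open>N(\<lambda>)\<close> tends to the matrix with rows
  \<open>(I\<^sub>1, I\<^sub>2)\<close>, \<open>(-I\<^sub>3, -I\<^sub>1)\<close>. Since \<open>\<Gamma>\<close> does not change under \<open>A \<mapsto> \<alpha> A + \<beta>\<close> with \<open>\<alpha> \<noteq> 0\<close> and is
  continuous at this limit, whose eigenvalues \<open>\<plusminus> i \<surd>(I\<^sub>2 I\<^sub>3 - I\<^sub>1\<^sup>2)\<close> are distinct by the strict
  Cauchy-Schwarz inequality, the claim follows.\<close>

subsection \<open>Absolutely continuous functions\<close>

lemma continuous_on_Icc_bounded:
  fixes f :: "real \<Rightarrow> 'a::real_normed_vector"
  assumes "continuous_on {a..b} f"
  obtains B where "B > 0" "\<And>x. x \<in> {a..b} \<Longrightarrow> norm (f x) \<le> B"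
  using compact_imp_bounded[OF compact_continuous_image[OF assms compact_Icc]]
  unfolding bounded_pos by blast

lemma obtain_pos_factor:
  fixes e y :: "'a::linordered_field"
  assumes "e > 0" "y > 0"
  obtains t where "t > 0" "t * y = e"
  using assms that[of "e / y"] by simp

text \<open>A division fine enough for both \<open>f\<close> and \<open>g\<close> also serves
  \<open>h\<close>. Suitable constants \<open>B\<close> cover differences, products on a compact
  interval and, with \<open>g = f\<close>, the entries of a matrix function.\<close>

lemma abs_continuous_onI_dominated:
  fixes f :: "real \<Rightarrow> 'a::real_normed_vector" and g :: "real \<Rightarrow> 'b::real_normed_vector"
    and h :: "real \<Rightarrow> 'c::real_normed_vector"
  assumes f: "abs_continuous_on S f" and g: "abs_continuous_on S g" and "B \<ge> 0"
    and h: "\<And>x y. x \<in> S \<Longrightarrow> y \<in> S \<Longrightarrow> norm (h x - h y) \<le> B * (norm (f x - f y) + norm (g x - g y))"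
  shows "abs_continuous_on S h"
  unfolding abs_continuous_on_def
proof safe
  fix e :: real assume "e > 0"
  \<comment> \<open>The summand 1 keeps the divisor positive if \<open>B = 0\<close> and makes the
    final estimate strict: \<open>B * (e' + e') = e - e'\<close>.\<close>
  have "2 * B + 1 > 0" using \<open>B \<ge> 0\<close> by simp
  with \<open>e > 0\<close> obtain e' where "e' > 0" "e' * (2 * B + 1) = e"
    by (rule obtain_pos_factor)
  then have e': "e' > 0" "B * (e' + e') < e"
    by (auto simp: algebra_simps)
  obtain d1 where "d1 > 0" and d1: "\<And>D. D division_of \<Union>D \<Longrightarrow> \<Union>D \<subseteq> S \<Longrightarrow>
      (\<Sum>K\<in>D. Sup K - Inf K) < d1 \<Longrightarrow> (\<Sum>K\<in>D. norm (f (Sup K) - f (Inf K))) < e'"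
    using f e'(1) unfolding abs_continuous_on_def by meson
  obtain d2 where "d2 > 0" and d2: "\<And>D. D division_of \<Union>D \<Longrightarrow> \<Union>D \<subseteq> S \<Longrightarrow>
      (\<Sum>K\<in>D. Sup K - Inf K) < d2 \<Longrightarrow> (\<Sum>K\<in>D. norm (g (Sup K) - g (Inf K))) < e'"
    using g e'(1) unfolding abs_continuous_on_def by meson
  show "\<exists>d>0. \<forall>D. D division_of \<Union>D \<and> \<Union>D \<subseteq> S \<and> (\<Sum>K\<in>D. Sup K - Inf K) < d \<longrightarrow>
        (\<Sum>K\<in>D. norm (h (Sup K) - h (Inf K))) < e"
  proof (intro exI[of _ "min d1 d2"] conjI allI impI)
    show "min d1 d2 > 0" using \<open>d1 > 0\<close> \<open>d2 > 0\<close> by simp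
    fix D assume D: "D division_of \<Union>D \<and> \<Union>D \<subseteq> S \<and> (\<Sum>K\<in>D. Sup K - Inf K) < min d1 d2"
    have "(\<Sum>K\<in>D. norm (h (Sup K) - h (Inf K))) \<le>
        (\<Sum>K\<in>D. B * (norm (f (Sup K) - f (Inf K)) + norm (g (Sup K) - g (Inf K))))"
    proof (rule sum_mono)
      fix K assume K: "K \<in> D"
      obtain u v where uv: "K = cbox u v" "K \<noteq> {}" "K \<subseteq> \<Union>D"
        using division_ofD(2,3,4)[of D "\<Union>D" K] D K by blast
      then have "K \<subseteq> S" "Sup K \<in> K" "Inf K \<in> K" using D by auto
      then have "Sup K \<in> S" "Inf K \<in> S" by auto
      then show "norm (h (Sup K) - h (Inf K)) \<le> B * (norm (f (Sup K) - f (Inf K)) + norm (g (Sup K) - g (Inf K)))"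
        by (rule h)
    qed
    also have "\<dots> = B * ((\<Sum>K\<in>D. norm (f (Sup K) - f (Inf K))) + (\<Sum>K\<in>D. norm (g (Sup K) - g (Inf K))))"
      by (simp only: sum.distrib sum_distrib_left[symmetric])
    also have "\<dots> \<le> B * (e' + e')"
      using d1[of D] d2[of D] D \<open>B \<ge> 0\<close> by (intro mult_left_mono) auto
    also have "\<dots> < e" by (rule e'(2))
    finally show "(\<Sum>K\<in>D. norm (h (Sup K) - h (Inf K))) < e" .
  qed
qed

lemma abs_continuous_on_imp_continuous_on:
  fixes f :: "real \<Rightarrow> 'a::real_normed_vector"
  assumes "abs_continuous_on {c..d} f"
  shows "continuous_on {c..d} f"
  unfolding continuous_on_iff
proof (intro ballI allI impI)
  fix x e :: real assume x: "x \<in> {c..d}" and "e > 0"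
  then obtain r where "r > 0" and r: "\<And>D. D division_of \<Union>D \<Longrightarrow> \<Union>D \<subseteq> {c..d} \<Longrightarrow>
      (\<Sum>K\<in>D. Sup K - Inf K) < r \<Longrightarrow> (\<Sum>K\<in>D. norm (f (Sup K) - f (Inf K))) < e"
    using assms unfolding abs_continuous_on_def by meson
  have "dist (f y) (f x) < e" if "y \<in> {c..d}" "dist y x < r" for y
  proof -
    \<comment> \<open>Absolute continuity is applied to the division that consists of the single
      interval between \<open>x\<close> and \<open>y\<close>.\<close>
    define u v where "u = min x y" and "v = max x y"
    have "{cbox u v} division_of \<Union>{cbox u v}"
      using division_of_self[of u v] by (simp add: u_def v_def)
    from r[OF this] have "norm (f v - f u) < e"
      using that x by (auto simp: u_def v_def dist_real_def max_def min_def split: if_splits)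
    then show ?thesis by (auto simp: u_def v_def dist_norm norm_minus_commute max_def min_def split: if_splits)
  qed
  then show "\<exists>r>0. \<forall>y\<in>{c..d}. dist y x < r \<longrightarrow> dist (f y) (f x) < e"
    using \<open>r > 0\<close> by blast
qed

section \<open>The fundamental theorem of calculus with an almost everywhere derivative\<close>

lemma division_content_le_measure:
  fixes U :: "'a::euclidean_space set"
  assumes "D division_of \<Union>D" "\<Union>D \<subseteq> U" "U \<in> lmeasurable"
  shows "(\<Sum>K\<in>D. measure lborel K) \<le> measure lebesgue U"
proof -
  \<comment> \<open>Lengths in gauge sums are taken in \<open>lborel\<close>, the measure of
    \<open>U\<close> in \<open>lebesgue\<close>; both agree on compact intervals.\<close>
  have "(\<Sum>K\<in>D. measure lborel K) = (\<Sum>K\<in>D. measure lebesgue K)"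
  proof (intro sum.cong refl)
    fix K assume "K \<in> D"
    then obtain u v where "K = cbox u v" using division_ofD(4)[OF assms(1)] by blast
    then show "measure lborel K = measure lebesgue K" by (simp add: measure_completion)
  qed
  also have "\<dots> = measure lebesgue (\<Union>D)"
    by (rule content_division[OF assms(1)])
  also have "\<dots> \<le> measure lebesgue U"
    using assms lmeasurable_division[OF assms(1)] by (intro measure_mono_fmeasurable) auto
  finally show ?thesis .
qed

text \<open>For a sufficiently fine tagged division, absolute continuity controls the intervals whose
  tag lies in the exceptional null set, since they lie in an open set of small measure.\<close>

theorem fundamental_theorem_abs_continuous:
  fixes f g :: "real \<Rightarrow> 'a::banach"
  assumes ac: "abs_continuous_on {c..d} f" and "c \<le> d"
    and deriv: "AE x in lebesgue. (f has_vector_derivative g x) (at x)"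
    and bdd: "bounded (g ` {c..d})"
  shows "(g has_integral (f d - f c)) {c..d}"
proof -
  define N where "N = {x. \<not> (f has_vector_derivative g x) (at x)}"
  have N: "negligible N"
    using deriv by (simp add: completion.AE_iff_null_sets negligible_iff_null_sets N_def)
  \<comment> \<open>At points of \<open>N\<close> the values of \<open>g\<close> are unrelated to
    \<open>f\<close>; there only this bound controls the Riemann terms.\<close>
  obtain B where "B > 0" and B: "\<And>x. x \<in> {c..d} \<Longrightarrow> norm (g x) \<le> B"
    using bdd by (auto simp: bounded_pos)
  show ?thesis
    unfolding has_integral_real
  proof safe
    fix e :: real assume "e > 0"
    \<comment> \<open>Half of \<open>e\<close> is reserved for tags outside \<open>N\<close>, a
      quarter for the increments of \<open>f\<close> and a quarter for the terms with
      \<open>g\<close> at tags in \<open>N\<close>. The summand 1 covers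
      \<open>c = d\<close>.\<close>
    have "e / 2 > 0" "d - c + 1 > 0" using \<open>c \<le> d\<close> \<open>e > 0\<close> by simp_all
    then obtain e1 where "e1 > 0" "e1 * (d - c + 1) = e / 2"
      by (rule obtain_pos_factor)
    then have e1: "e1 > 0" "e1 * (d - c) < e / 2"
      by (auto simp: algebra_simps)
    have "e / 4 > 0" using \<open>e > 0\<close> by simp
    then obtain r where "r > 0" and r: "\<And>D. D division_of \<Union>D \<Longrightarrow> \<Union>D \<subseteq> {c..d} \<Longrightarrow>
        (\<Sum>K\<in>D. Sup K - Inf K) < r \<Longrightarrow> (\<Sum>K\<in>D. norm (f (Sup K) - f (Inf K))) < e / 4"
      using ac unfolding abs_continuous_on_def by meson
    \<comment> \<open>\<open>e2\<close> will bound the total length of the cells with tag in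
      \<open>N\<close>: below \<open>r\<close> absolute continuity applies, and below
      \<open>e / (4 * B)\<close> the terms with \<open>g\<close> sum to at most
      \<open>e / 4\<close>.\<close>
    define e2 where "e2 = min r (e / (4 * B))"
    have "e2 > 0" using \<open>r > 0\<close> \<open>e > 0\<close> \<open>B > 0\<close> by (auto simp: e2_def)
    obtain U where "open U" "N \<subseteq> U" and UN: "U - N \<in> lmeasurable" "emeasure lebesgue (U - N) < ennreal e2"
      using sets_lebesgue_outer_open[of N e2] N \<open>e2 > 0\<close> negligible_imp_sets by blast
    have U: "U \<in> lmeasurable" "measure lebesgue U < e2"
    proof -
      have *: "U = (U - N) \<union> N" using \<open>N \<subseteq> U\<close> by auto
      have "N \<in> lmeasurable" using N by (rule negligible_imp_measurable)
      show "U \<in> lmeasurable" by (subst *) (intro fmeasurable.Un UN(1) \<open>N \<in> lmeasurable\<close>)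
      have "measure lebesgue U \<le> measure lebesgue (U - N) + measure lebesgue N"
        by (subst *) (intro measure_Un_le fmeasurableD UN(1) \<open>N \<in> lmeasurable\<close>)
      also have "measure lebesgue N = 0" using N by (simp add: negligible_imp_measure0)
      also have "measure lebesgue (U - N) < e2"
        using UN \<open>e2 > 0\<close> by (simp add: emeasure_eq_measure2 ennreal_less_iff)
      finally show "measure lebesgue U < e2" by simp
    qed
    \<comment> \<open>These radii form the gauge: cells tagged in \<open>N\<close> are forced into
      the small set \<open>U\<close>, all others are short enough for the linear approximation of
      \<open>f\<close> at the tag.\<close>
    have "\<exists>b>0. (x \<in> N \<longrightarrow> ball x b \<subseteq> U) \<and> (x \<notin> N \<longrightarrow>
        (\<forall>y. norm (y - x) < b \<longrightarrow> norm (f y - f x - (y - x) *\<^sub>R g x) \<le> e1 * norm (y - x)))" for x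
    proof (cases "x \<in> N")
      case True
      then show ?thesis using \<open>open U\<close> \<open>N \<subseteq> U\<close> by (metis openE subsetD)
    next
      case False
      then have "(f has_derivative (\<lambda>t. t *\<^sub>R g x)) (at x)"
        by (simp add: N_def has_vector_derivative_def)
      then show ?thesis
        using False e1(1) unfolding has_derivative_within_alt by auto
    qed
    then obtain b where b: "\<And>x. b x > 0" "\<And>x. x \<in> N \<Longrightarrow> ball x (b x) \<subseteq> U"
      "\<And>x y. x \<notin> N \<Longrightarrow> norm (y - x) < b x \<Longrightarrow> norm (f y - f x - (y - x) *\<^sub>R g x) \<le> e1 * norm (y - x)"
      by metis
    show "\<exists>\<gamma>. gauge \<gamma> \<and> (\<forall>p. p tagged_division_of {c..d} \<and> \<gamma> fine p \<longrightarrow>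
        norm ((\<Sum>(x, k)\<in>p. measure lborel k *\<^sub>R g x) - (f d - f c)) < e)"
    proof (intro exI[of _ "\<lambda>x. ball x (b x)"] conjI allI impI)
      show "gauge (\<lambda>x. ball x (b x))" using b(1) gauge_ball_dependent by blast
      fix p assume "p tagged_division_of {c..d} \<and> (\<lambda>x. ball x (b x)) fine p"
      then have p: "p tagged_division_of {c..d}" and fine: "(\<lambda>x. ball x (b x)) fine p" by auto
      have "finite p" using p by blast
      have K: "\<exists>u v. K = {u..v} \<and> u \<le> v \<and> x \<in> {u..v} \<and> {u..v} \<subseteq> {c..d} \<and> {u..v} \<subseteq> ball x (b x)"
        if xK: "(x, K) \<in> p" for x K
      proof -
        obtain u v where uv: "K = cbox u v" using tagged_division_ofD(4)[OF p xK] by blast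
        moreover have "x \<in> K" "K \<subseteq> {c..d}" using tagged_division_ofD(2,3)[OF p xK] by auto
        moreover have "K \<subseteq> ball x (b x)" using fine xK by (auto simp: fine_def)
        ultimately show ?thesis by (metis atLeastAtMost_iff box_real(2) order_trans)
      qed
      define p1 p2 where "p1 = {z \<in> p. fst z \<in> N}" and "p2 = {z \<in> p. fst z \<notin> N}"
      have pp: "p = p1 \<union> p2" "p1 \<inter> p2 = {}" "finite p1" "finite p2"
        using \<open>finite p\<close> by (auto simp: p1_def p2_def)
      \<comment> \<open>\<open>T\<close> is the error of one tagged cell. The increments of
        \<open>f\<close> telescope to \<open>f d - f c\<close>, so these errors sum to the total
        error.\<close>
      define T where "T = (\<lambda>(x, K). measure lborel K *\<^sub>R g x - (f (Sup K) - f (Inf K)))"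
      have "(\<Sum>(x, k)\<in>p. measure lborel k *\<^sub>R g x) - (f d - f c) = sum T p"
        using additive_tagged_division_1[OF \<open>c \<le> d\<close> p, of f]
        by (simp add: T_def split_def sum_subtractf)
      also have "\<dots> = sum T p1 + sum T p2"
        using pp by (simp add: sum.union_disjoint)
      also have "norm \<dots> \<le> (\<Sum>z\<in>p1. norm (T z)) + (\<Sum>z\<in>p2. norm (T z))"
        by (intro norm_triangle_le add_mono norm_sum)
      also have "(\<Sum>z\<in>p2. norm (T z)) < e / 2"
      proof -
        have "(\<Sum>z\<in>p2. norm (T z)) \<le> (\<Sum>(x, K)\<in>p2. e1 * (Sup K - Inf K))"
        proof (rule sum_mono, clarify)
          fix x K assume "(x, K) \<in> p2"
          then have xK: "(x, K) \<in> p" "x \<notin> N" by (auto simp: p2_def)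
          obtain u v where uv: "K = {u..v}" "u \<le> x" "x \<le> v" "{u..v} \<subseteq> ball x (b x)"
            using K[OF xK(1)] by auto
          have "u \<in> ball x (b x)" "v \<in> ball x (b x)"
            using subsetD[OF uv(4), of u] subsetD[OF uv(4), of v] uv(2,3) by simp_all
          then have "norm (f v - f x - (v - x) *\<^sub>R g x) \<le> e1 * norm (v - x)"
            "norm (f u - f x - (u - x) *\<^sub>R g x) \<le> e1 * norm (u - x)"
            using b(3)[OF xK(2)] by (auto simp: dist_norm norm_minus_commute)
          \<comment> \<open>The cell is split at its tag; since \<open>u \<le> x \<le> v\<close>,
            the two approximation errors add up to at most \<open>e1 * (v - u)\<close>.\<close>
          moreover have "T (x, K) = (f u - f x - (u - x) *\<^sub>R g x) - (f v - f x - (v - x) *\<^sub>R g x)"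
            using uv by (simp add: T_def scaleR_left_diff_distrib)
          ultimately have "norm (T (x, K)) \<le> e1 * norm (u - x) + e1 * norm (v - x)"
            by (simp only:) (rule order_trans[OF norm_triangle_ineq4], linarith)
          then show "norm (T (x, K)) \<le> e1 * (Sup K - Inf K)"
            using uv by (simp add: algebra_simps)
        qed
        also have "\<dots> \<le> (\<Sum>(x, K)\<in>p. e1 * (Sup K - Inf K))"
        proof (intro sum_mono2)
          fix z assume "z \<in> p - p2"
          then obtain x K where z: "z = (x, K)" "(x, K) \<in> p" by (cases z) auto
          show "0 \<le> (case z of (x, K) \<Rightarrow> e1 * (Sup K - Inf K))"
            using K[OF z(2)] e1(1) by (auto simp: z(1))
        qed (use \<open>finite p\<close> in \<open>auto simp: p2_def\<close>)
        also have "\<dots> = e1 * (\<Sum>(x, K)\<in>p. Sup K - Inf K)"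
          by (simp add: sum_distrib_left split_def)
        also have "\<dots> = e1 * (d - c)"
          using additive_tagged_division_1[OF \<open>c \<le> d\<close> p, of "\<lambda>x. x"] by simp
        finally show ?thesis using e1(2) by simp
      qed
      also have "(\<Sum>z\<in>p1. norm (T z)) \<le> e / 2"
      proof -
        define D where "D = snd ` p1"
        have tp1: "p1 tagged_partial_division_of {c..d}"
          by (rule tagged_partial_division_subset[of p]) (use p in \<open>auto simp: p1_def tagged_division_of_def\<close>)
        have D: "D division_of \<Union>D"
          unfolding D_def by (rule partial_division_of_tagged_division[OF tp1])
        have DK: "\<exists>u v. K = {u..v} \<and> u \<le> v \<and> {u..v} \<subseteq> {c..d} \<and> {u..v} \<subseteq> U" if KD: "K \<in> D" for K
        proof -
          obtain x where x: "(x, K) \<in> p" "x \<in> N" using KD unfolding D_def p1_def by auto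
          obtain u v where uv: "K = {u..v}" "u \<le> v" "{u..v} \<subseteq> {c..d}" "{u..v} \<subseteq> ball x (b x)"
            using K[OF x(1)] by blast
          have "{u..v} \<subseteq> U" using uv(4) b(2)[OF x(2)] by (rule order_trans)
          with uv show ?thesis by blast
        qed
        have DK': "K \<noteq> {} \<and> measure lborel K = Sup K - Inf K \<and> K \<subseteq> {c..d} \<and> K \<subseteq> U" if "K \<in> D" for K
          using DK[OF that] by auto
        have DS: "\<Union>D \<subseteq> {c..d}" "\<Union>D \<subseteq> U" using DK' by (meson Union_least)+
        have len: "(\<Sum>K\<in>D. Sup K - Inf K) = (\<Sum>K\<in>D. measure lborel K)"
          using DK' by (intro sum.cong) auto
        have DU: "(\<Sum>K\<in>D. measure lborel K) < e2"
          using division_content_le_measure[OF D DS(2) U(1)] U(2) by simp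
        \<comment> \<open>A cell can carry several tags, but only if it is degenerate; sums over
          pairs and over cells then agree because \<open>F\<close> vanishes on singletons.\<close>
        have tag: "(\<Sum>(x, K)\<in>p1. norm (F K)) = (\<Sum>K\<in>D. norm (F K))" if F: "\<And>u. F {u} = 0"
          for F :: "real set \<Rightarrow> 'a"
        proof -
          define F' where "F' K = (if K = {} then 0 else norm (F K))" for K
          have "(\<Sum>(x, K)\<in>p1. F' K) = sum F' (snd ` p1)"
          proof (rule sum.over_tagged_division_lemma[OF tagged_partial_division_of_Union_self[OF tp1]])
            fix u v :: real assume "box u v = {}"
            then show "F' (cbox u v) = 0" using F by (cases "u = v") (auto simp: F'_def)
          qed
          moreover have "(\<Sum>(x, K)\<in>p1. F' K) = (\<Sum>(x, K)\<in>p1. norm (F K))"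

          using DK' by (intro sum.cong) (auto simp: F'_def D_def image_iff split_def)
          moreover have "sum F' (snd ` p1) = (\<Sum>K\<in>D. norm (F K))"
            unfolding D_def[symmetric] using DK' by (intro sum.cong) (auto simp: F'_def)
          ultimately show ?thesis by simp
        qed
        have tagc: "(\<Sum>(x, K)\<in>p1. measure lborel K) = (\<Sum>K\<in>D. measure lborel K)"
          unfolding D_def
          by (rule sum.over_tagged_division_lemma[OF tagged_partial_division_of_Union_self[OF tp1]])
             (simp add: content_eq_0_interior)
        have "(\<Sum>z\<in>p1. norm (T z)) \<le> (\<Sum>(x, K)\<in>p1. B * measure lborel K + norm (f (Sup K) - f (Inf K)))"
        proof (rule sum_mono, clarify)
          fix x K assume "(x, K) \<in> p1"
          then have "(x, K) \<in> p" by (auto simp: p1_def)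
          then have "x \<in> {c..d}" using K[OF \<open>(x, K) \<in> p\<close>] by auto
          then have "norm (measure lborel K *\<^sub>R g x) \<le> B * measure lborel K"
            using B[of x] by (simp add: mult.commute[of B] mult_left_mono)
          then show "norm (T (x, K)) \<le> B * measure lborel K + norm (f (Sup K) - f (Inf K))"
            unfolding T_def prod.case by (metis add_right_mono norm_triangle_ineq4 order_trans)
        qed
        also have "\<dots> = B * (\<Sum>K\<in>D. measure lborel K) + (\<Sum>K\<in>D. norm (f (Sup K) - f (Inf K)))"
          using tag[of "\<lambda>K. f (Sup K) - f (Inf K)"] tagc
          by (simp add: split_def sum.distrib sum_distrib_left[symmetric])
        also have "\<dots> \<le> B * (e / (4 * B)) + e / 4"
        proof (intro add_mono mult_left_mono)
          show "(\<Sum>K\<in>D. norm (f (Sup K) - f (Inf K))) \<le> e / 4"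
            using r[OF D DS(1)] DU len by (simp add: e2_def)
        qed (use DU \<open>B > 0\<close> in \<open>auto simp: e2_def\<close>)
        also have "\<dots> = e / 2" using \<open>B > 0\<close> by simp
        finally show ?thesis .
      qed
      finally show "norm ((\<Sum>(x, k)\<in>p. measure lborel k *\<^sub>R g x) - (f d - f c)) < e" by simp
    qed
  qed
qed

section \<open>Differences and products of absolutely continuous functions\<close>

lemma abs_continuous_on_diff:
  fixes f g :: "real \<Rightarrow> 'a::real_normed_vector"
  assumes "abs_continuous_on S f" "abs_continuous_on S g"
  shows "abs_continuous_on S (\<lambda>x. f x - g x)"
proof (rule abs_continuous_onI_dominated[OF assms, of 1])
  fix x y
  have "f x - g x - (f y - g y) = (f x - f y) - (g x - g y)" by simp
  then show "norm (f x - g x - (f y - g y)) \<le> 1 * (norm (f x - f y) + norm (g x - g y))"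
    by (metis mult_1 norm_triangle_ineq4)
qed simp

text \<open>The product rule for increments needs bounded factors, which continuity on a compact
  interval provides; hence \<open>{c..d}\<close> in place of a general \<open>S\<close>.\<close>

lemma abs_continuous_on_mult:
  fixes f g :: "real \<Rightarrow> 'a::real_normed_algebra"
  assumes f: "abs_continuous_on {c..d} f" and g: "abs_continuous_on {c..d} g"
  shows "abs_continuous_on {c..d} (\<lambda>x. f x * g x)"
proof -
  obtain F where F: "F > 0" "\<And>x. x \<in> {c..d} \<Longrightarrow> norm (f x) \<le> F"
    using continuous_on_Icc_bounded[OF abs_continuous_on_imp_continuous_on[OF f]] by blast
  obtain G where G: "G > 0" "\<And>x. x \<in> {c..d} \<Longrightarrow> norm (g x) \<le> G"
    using continuous_on_Icc_bounded[OF abs_continuous_on_imp_continuous_on[OF g]] by blast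
  show ?thesis
  proof (rule abs_continuous_onI_dominated[OF f g, of "F + G"])
    fix x y assume "x \<in> {c..d}" "y \<in> {c..d}"
    have "f x * g x - f y * g y = f x * (g x - g y) + (f x - f y) * g y"
      by (simp add: algebra_simps)
    also have "norm \<dots> \<le> norm (f x) * norm (g x - g y) + norm (f x - f y) * norm (g y)"
      by (intro norm_triangle_le add_mono norm_mult_ineq)
    also have "\<dots> \<le> (F + G) * norm (g x - g y) + norm (f x - f y) * (F + G)"
      using F(1) F(2)[OF \<open>x \<in> {c..d}\<close>] G(1) G(2)[OF \<open>y \<in> {c..d}\<close>]
      by (intro add_mono mult_left_mono mult_right_mono) auto
    finally show "norm (f x * g x - f y * g y) \<le> (F + G) * (norm (f x - f y) + norm (g x - g y))"
      by (simp add: algebra_simps)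
  qed (use F(1) G(1) in simp)
qed

lemma locally_abs_continuous_imp_continuous_on:
  "locally_abs_continuous f \<Longrightarrow> continuous_on {c..d} f"
  by (simp add: locally_abs_continuous_def abs_continuous_on_imp_continuous_on)

subsection \<open>Wronskians of Dirac solutions\<close>

text \<open>One column of the Dirac system, by components and solved for the derivatives: -i sigma_2
  has rows (0, -1) and (1, 0).\<close>

definition dirac_pair ::
    "real \<Rightarrow> (real \<Rightarrow> real) \<Rightarrow> complex \<Rightarrow> (real \<Rightarrow> complex) \<Rightarrow> (real \<Rightarrow> complex) \<Rightarrow> bool" where
  "dirac_pair m q lam y1 y2 \<longleftrightarrow>
     locally_abs_continuous y1 \<and> locally_abs_continuous y2 \<and>
     (AE x in lebesgue.
        (y1 has_vector_derivative (lam - of_real (q x) + of_real m) * y2 x) (at x) \<and>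
        (y2 has_vector_derivative (of_real m + of_real (q x) - lam) * y1 x) (at x))"

lemma dirac_pair_column:
  assumes "dirac_matrix_solution m q lam Y"
  shows "dirac_pair m q lam (\<lambda>x. Y x $ 1 $ j) (\<lambda>x. Y x $ 2 $ j)"
  unfolding dirac_pair_def
proof (intro conjI)
  have "locally_abs_continuous (\<lambda>x. Y x $ i $ j)" for i
  proof -
    have "abs_continuous_on {c..d} (\<lambda>x. Y x $ i $ j)" for c d
    proof (rule abs_continuous_onI_dominated[of _ Y Y 1])
      show "abs_continuous_on {c..d} Y" "abs_continuous_on {c..d} Y"
        using assms by (auto simp: dirac_matrix_solution_def locally_abs_continuous_def)
      fix x y
      have "norm (Y x $ i $ j - Y y $ i $ j) \<le> norm (Y x - Y y)"
        by (metis Finite_Cartesian_Product.norm_nth_le order_trans vector_minus_component)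
      then show "norm (Y x $ i $ j - Y y $ i $ j) \<le> 1 * (norm (Y x - Y y) + norm (Y x - Y y))"
        by (smt (verit) mult_1 norm_ge_zero)
    qed simp
    then show ?thesis by (simp add: locally_abs_continuous_def)
  qed
  then show "locally_abs_continuous (\<lambda>x. Y x $ 1 $ j)" "locally_abs_continuous (\<lambda>x. Y x $ 2 $ j)"
    by blast+
  have "AE x in lebesgue. \<exists>Y'. (Y has_vector_derivative Y') (at x) \<and>
        mat (- \<i>) ** sigma2 ** Y' + (mat (of_real m) ** sigma3 + mat (of_real (q x))) ** Y x
          = mat lam ** Y x"
    using assms by (simp add: dirac_matrix_solution_def)
  then show "AE x in lebesgue.
        ((\<lambda>x. Y x $ 1 $ j) has_vector_derivative (lam - of_real (q x) + of_real m) * Y x $ 2 $ j) (at x) \<and>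
        ((\<lambda>x. Y x $ 2 $ j) has_vector_derivative (of_real m + of_real (q x) - lam) * Y x $ 1 $ j) (at x)"
  proof eventually_elim
    case (elim x)
    then obtain Y' where d: "(Y has_vector_derivative Y') (at x)"
      and eq: "mat (- \<i>) ** sigma2 ** Y' + (mat (of_real m) ** sigma3 + mat (of_real (q x))) ** Y x
          = mat lam ** Y x" by blast
    have comp: "((\<lambda>x. Y x $ i $ j) has_vector_derivative Y' $ i $ j) (at x)" for i
      by (intro bounded_linear.has_vector_derivative[OF bounded_linear_vec_nth] d)
    have ent: "(mat (- \<i>) ** sigma2 ** Y' + (mat (of_real m) ** sigma3 + mat (of_real (q x))) ** Y x) $ i $ j
          = (mat lam ** Y x) $ i $ j" for i
      by (simp add: eq)
    \<comment> \<open>The derivative term is off-diagonal, so row 2 yields the derivative of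
      component 1, and row 1 that of component 2.\<close>
    have "Y' $ 1 $ j = (lam - of_real (q x) + of_real m) * Y x $ 2 $ j"
      using ent[of 2]
      by (simp add: matrix_matrix_mult_def sum_2 mat_def sigma2_def sigma3_def algebra_simps)
    moreover have "Y' $ 2 $ j = (of_real m + of_real (q x) - lam) * Y x $ 1 $ j"
      using ent[of 1]
      by (simp add: matrix_matrix_mult_def sum_2 mat_def sigma2_def sigma3_def algebra_simps)
    ultimately show ?case using comp by metis
  qed
qed

text \<open>The coefficients \<open>m\<close> and \<open>q\<close> are real, so conjugation affects
  only the parameter. This leads to real solutions at a real parameter.\<close>

lemma dirac_pair_cnj:
  assumes "dirac_pair m q lam y1 y2"
  shows "dirac_pair m q (cnj lam) (\<lambda>x. cnj (y1 x)) (\<lambda>x. cnj (y2 x))"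
proof -
  have ac: "abs_continuous_on S (\<lambda>x. cnj (f x))" if "abs_continuous_on S f" for S and f :: "real \<Rightarrow> complex"
    using that by (simp add: abs_continuous_on_def flip: complex_cnj_diff)
  have "AE x in lebesgue.
        (y1 has_vector_derivative (lam - of_real (q x) + of_real m) * y2 x) (at x) \<and>
        (y2 has_vector_derivative (of_real m + of_real (q x) - lam) * y1 x) (at x)"
    using assms by (simp add: dirac_pair_def)
  then have "AE x in lebesgue.
        ((\<lambda>x. cnj (y1 x)) has_vector_derivative (cnj lam - of_real (q x) + of_real m) * cnj (y2 x)) (at x) \<and>
        ((\<lambda>x. cnj (y2 x)) has_vector_derivative (of_real m + of_real (q x) - cnj lam) * cnj (y1 x)) (at x)"
  proof eventually_elim
    case (elim x)
    from elim[THEN conjunct1, THEN has_vector_derivative_cnj] elim[THEN conjunct2, THEN has_vector_derivative_cnj]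
    show ?case by simp
  qed
  then show ?thesis
    using assms by (auto simp: dirac_pair_def locally_abs_continuous_def intro: ac)
qed

text \<open>The terms with \<open>m\<close> and \<open>q\<close> cancel in the derivative of the
  Wronskian. The remaining integrand is continuous, hence bounded as the fundamental theorem
  requires, although \<open>q\<close> may be unbounded.\<close>

lemma wronskian_identity:
  assumes y: "dirac_pair m q lam y1 y2" and z: "dirac_pair m q mu z1 z2" and "x \<ge> 0"
  shows "y1 x * z2 x - y2 x * z1 x =
    y1 0 * z2 0 - y2 0 * z1 0 + (lam - mu) * integral {0..x} (\<lambda>t. y1 t * z1 t + y2 t * z2 t)"
proof -
  have ac: "abs_continuous_on {0..x} y1" "abs_continuous_on {0..x} y2"
    "abs_continuous_on {0..x} z1" "abs_continuous_on {0..x} z2"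
    using y z by (auto simp: dirac_pair_def locally_abs_continuous_def)
  note cont = ac[THEN abs_continuous_on_imp_continuous_on]
  have "AE t in lebesgue. (y1 has_vector_derivative (lam - of_real (q t) + of_real m) * y2 t) (at t) \<and>
        (y2 has_vector_derivative (of_real m + of_real (q t) - lam) * y1 t) (at t)"
    "AE t in lebesgue. (z1 has_vector_derivative (mu - of_real (q t) + of_real m) * z2 t) (at t) \<and>
        (z2 has_vector_derivative (of_real m + of_real (q t) - mu) * z1 t) (at t)"
    using y z by (simp_all add: dirac_pair_def)
  then have deriv: "AE t in lebesgue. ((\<lambda>t. y1 t * z2 t - y2 t * z1 t) has_vector_derivative
      (lam - mu) * (y1 t * z1 t + y2 t * z2 t)) (at t)"
  proof eventually_elim
    case (elim t)
    then have "((\<lambda>t. y1 t * z2 t - y2 t * z1 t) has_vector_derivative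
        y1 t * ((of_real m + of_real (q t) - mu) * z1 t) + ((lam - of_real (q t) + of_real m) * y2 t) * z2 t -
        (y2 t * ((mu - of_real (q t) + of_real m) * z2 t) + ((of_real m + of_real (q t) - lam) * y1 t) * z1 t)) (at t)"
      by (intro has_vector_derivative_diff has_vector_derivative_mult) auto
    then show ?case
      by (rule has_vector_derivative_eq_rhs) (simp add: algebra_simps)
  qed
  have "((\<lambda>t. (lam - mu) * (y1 t * z1 t + y2 t * z2 t)) has_integral
      (y1 x * z2 x - y2 x * z1 x - (y1 0 * z2 0 - y2 0 * z1 0))) {0..x}"
    by (intro fundamental_theorem_abs_continuous[where f = "\<lambda>t. y1 t * z2 t - y2 t * z1 t"]
        abs_continuous_on_diff abs_continuous_on_mult ac \<open>x \<ge> 0\<close> deriv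
        compact_imp_bounded compact_continuous_image continuous_intros cont compact_Icc)
  then have "integral {0..x} (\<lambda>t. (lam - mu) * (y1 t * z1 t + y2 t * z2 t)) =
      y1 x * z2 x - y2 x * z1 x - (y1 0 * z2 0 - y2 0 * z1 0)"
    by (rule integral_unique)
  then show ?thesis by simp
qed

subsection \<open>The angle between eigenvectors\<close>

text \<open>The value of \<open>\<Gamma>\<close> at a matrix with rows \<open>(t + p, b)\<close>, \<open>(c, t - p)\<close>, obtained from the eigenvectors
  \<open>(b, \<plusminus>r - p)\<close> with \<open>r\<^sup>2 = p\<^sup>2 + b c\<close>.\<close>

definition eigenvector_angle :: "complex \<Rightarrow> complex \<Rightarrow> complex \<Rightarrow> real" where
  "eigenvector_angle p b c = 2 * sqrt (cmod (p\<^sup>2 + b * c)) /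
     sqrt (2 * (cmod p)\<^sup>2 + (cmod b)\<^sup>2 + (cmod c)\<^sup>2 + 2 * cmod (p\<^sup>2 + b * c))"

text \<open>Numerator and denominator are both homogeneous of degree 1 in \<open>cmod k\<close>.
  This removes the factor \<open>s * (lam - l0)\<close>, which degenerates in the limit.\<close>

lemma eigenvector_angle_scale:
  assumes "k \<noteq> 0"
  shows "eigenvector_angle (k * p) (k * b) (k * c) = eigenvector_angle p b c"
proof -
  have "(k * p)\<^sup>2 + k * b * (k * c) = k\<^sup>2 * (p\<^sup>2 + b * c)"
    by (simp add: power2_eq_square algebra_simps)
  then have 1: "cmod ((k * p)\<^sup>2 + k * b * (k * c)) = (cmod k)\<^sup>2 * cmod (p\<^sup>2 + b * c)"
    by (simp add: norm_mult norm_power)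
  have 2: "2 * (cmod (k * p))\<^sup>2 + (cmod (k * b))\<^sup>2 + (cmod (k * c))\<^sup>2 + 2 * ((cmod k)\<^sup>2 * cmod (p\<^sup>2 + b * c))
    = (cmod k)\<^sup>2 * (2 * (cmod p)\<^sup>2 + (cmod b)\<^sup>2 + (cmod c)\<^sup>2 + 2 * cmod (p\<^sup>2 + b * c))"
    by (simp add: norm_mult power_mult_distrib algebra_simps)
  show ?thesis
    using assms unfolding eigenvector_angle_def 1 2 by (simp add: real_sqrt_mult)
qed

lemma norm_vec2: "norm (w :: complex^2) = sqrt ((cmod (w $ 1))\<^sup>2 + (cmod (w $ 2))\<^sup>2)"
  by (simp add: norm_vec_def L2_set_def sum_2)

text \<open>Subtracting half the trace leaves a traceless matrix with diagonal \<open>p\<close>,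
  \<open>- p\<close> and eigenvalue \<open>r\<close>, whose square is minus its determinant. As the
  upper right entry \<open>b\<close> is nonzero, \<open>w\<close> is a multiple of
  \<open>(b, r - p)\<close>.\<close>

lemma is_eigenvector_2D:
  assumes "is_eigenvector A e w" and b: "A $ 1 $ 2 \<noteq> 0"
    and p: "p = (A $ 1 $ 1 - A $ 2 $ 2) / 2" and r: "r = e - (A $ 1 $ 1 + A $ 2 $ 2) / 2"
  shows "w $ 1 \<noteq> 0" "A $ 1 $ 2 * w $ 2 = (r - p) * w $ 1" "r\<^sup>2 = p\<^sup>2 + A $ 1 $ 2 * A $ 2 $ 1"
proof -
  have "A *v w = e *s w" "w \<noteq> 0" using assms(1) by (auto simp: is_eigenvector_def)
  then have e1: "A $ 1 $ 1 * w $ 1 + A $ 1 $ 2 * w $ 2 = e * w $ 1"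
    and e2: "A $ 2 $ 1 * w $ 1 + A $ 2 $ 2 * w $ 2 = e * w $ 2"
    by (auto simp: vec_eq_iff matrix_vector_mult_def sum_2 forall_2)
  have rp: "r - p = e - A $ 1 $ 1" "r + p = e - A $ 2 $ 2"
    by (simp_all add: p r field_simps)
  show w2: "A $ 1 $ 2 * w $ 2 = (r - p) * w $ 1"
    using e1 by (simp add: rp algebra_simps)
  show w1: "w $ 1 \<noteq> 0"
  proof
    assume "w $ 1 = 0"
    with w2 b have "w $ 2 = 0" by simp
    with \<open>w $ 1 = 0\<close> have "w = 0" by (simp add: vec_eq_iff forall_2)
    with \<open>w \<noteq> 0\<close> show False by simp
  qed
  have "A $ 1 $ 2 * A $ 2 $ 1 * w $ 1 = (r + p) * (A $ 1 $ 2 * w $ 2)"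
    using e2 unfolding rp by (simp add: algebra_simps) algebra
  also have "\<dots> = (r + p) * (r - p) * w $ 1" by (simp add: w2)
  finally have "A $ 1 $ 2 * A $ 2 $ 1 = (r + p) * (r - p)" using w1 by simp
  then show "r\<^sup>2 = p\<^sup>2 + A $ 1 $ 2 * A $ 2 $ 1" by (simp add: power2_eq_square algebra_simps)
qed

text \<open>For the eigenvectors \<open>(b, r - p)\<close> and \<open>(b, - r - p)\<close> the
  determinant is \<open>- 2 * r * b\<close>. The product of their norms follows from the
  parallelogram law and \<open>(r - p) * (- r - p) = - (b * c)\<close>. Scaling of \<open>w\<close>
  and \<open>z\<close> cancels in the ratio.\<close>

lemma eigenvector_ratio_eq:
  fixes A :: "complex^2^2"
  assumes w: "is_eigenvector A e w" and z: "is_eigenvector A e' z" and "e \<noteq> e'" and b: "A $ 1 $ 2 \<noteq> 0"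
  shows "cmod (det (transpose (vector [w, z]))) / (norm w * norm z) =
    eigenvector_angle ((A $ 1 $ 1 - A $ 2 $ 2) / 2) (A $ 1 $ 2) (A $ 2 $ 1)"
proof -
  define p where "p = (A $ 1 $ 1 - A $ 2 $ 2) / 2"
  define r where "r = e - (A $ 1 $ 1 + A $ 2 $ 2) / 2"
  define r' where "r' = e' - (A $ 1 $ 1 + A $ 2 $ 2) / 2"
  define B C where "B = A $ 1 $ 2" and "C = A $ 2 $ 1"
  note W = is_eigenvector_2D[OF w b p_def r_def, folded B_def C_def]
  note Z = is_eigenvector_2D[OF z b p_def r'_def, folded B_def C_def]
  have "B \<noteq> 0" using b by (simp add: B_def)
  have "r\<^sup>2 = r'\<^sup>2" using W(3) Z(3) by simp
  then have "r' = - r" using \<open>e \<noteq> e'\<close> by (auto simp: r_def r'_def power2_eq_iff)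
  have "B * (w $ 1 * z $ 2 - w $ 2 * z $ 1) = w $ 1 * (B * z $ 2) - (B * w $ 2) * z $ 1"
    by (simp add: algebra_simps)
  also have "\<dots> = (w $ 1 * z $ 1) * (- 2 * r)"
    unfolding W(2) Z(2) \<open>r' = - r\<close> by (simp add: algebra_simps)
  finally have "cmod B * cmod (w $ 1 * z $ 2 - w $ 2 * z $ 1) = cmod ((w $ 1 * z $ 1) * (- 2 * r))"
    by (metis norm_mult)
  moreover have "det (transpose (vector [w, z])) = w $ 1 * z $ 2 - w $ 2 * z $ 1"
    by (simp add: det_2 transpose_def)
  ultimately have det: "cmod B * cmod (det (transpose (vector [w, z]))) =
      2 * cmod r * (cmod (w $ 1) * cmod (z $ 1))"
    by (simp add: norm_mult)
  \<comment> \<open>Multiplying by \<open>cmod B\<close> avoids normalising the eigenvectors: their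
    first components become common factors of determinant and norms.\<close>
  have norm_scaled: "cmod B * norm v = cmod (v $ 1) * sqrt ((cmod B)\<^sup>2 + (cmod k)\<^sup>2)"
    if "B * v $ 2 = k * v $ 1" for v :: "complex^2" and k
  proof -
    have "cmod B * norm v = sqrt ((cmod B * cmod (v $ 1))\<^sup>2 + (cmod B * cmod (v $ 2))\<^sup>2)"
      unfolding norm_vec2 by (simp add: power_mult_distrib real_sqrt_mult flip: distrib_left)
    also have "cmod B * cmod (v $ 2) = cmod k * cmod (v $ 1)"
      using that by (metis norm_mult)
    also have "(cmod B * cmod (v $ 1))\<^sup>2 + (cmod k * cmod (v $ 1))\<^sup>2 =
        (cmod (v $ 1))\<^sup>2 * ((cmod B)\<^sup>2 + (cmod k)\<^sup>2)"
      by (simp add: power_mult_distrib algebra_simps)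
    finally show ?thesis by (simp add: real_sqrt_mult)
  qed
  have para: "(cmod (r - p))\<^sup>2 + (cmod (- r - p))\<^sup>2 = 2 * (cmod r)\<^sup>2 + 2 * (cmod p)\<^sup>2"
    unfolding cmod_power2 by (simp add: power2_eq_square algebra_simps)
  have "(r - p) * (- r - p) = - (B * C)"
    using W(3) by (simp add: algebra_simps power2_eq_square)
  then have prod: "cmod (r - p) * cmod (- r - p) = cmod B * cmod C"
    by (metis norm_minus_cancel norm_mult)
  have r2: "(cmod r)\<^sup>2 = cmod (p\<^sup>2 + B * C)"
    by (simp add: W(3)[symmetric] norm_power)
  have "((cmod B)\<^sup>2 + (cmod (r - p))\<^sup>2) * ((cmod B)\<^sup>2 + (cmod (- r - p))\<^sup>2) =
    (cmod B)\<^sup>2 * (cmod B)\<^sup>2 + (cmod B)\<^sup>2 * ((cmod (r - p))\<^sup>2 + (cmod (- r - p))\<^sup>2)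
      + (cmod (r - p) * cmod (- r - p))\<^sup>2"
    by (simp add: algebra_simps power_mult_distrib)
  also have "\<dots> = (cmod B)\<^sup>2 * (2 * (cmod p)\<^sup>2 + (cmod B)\<^sup>2 + (cmod C)\<^sup>2 + 2 * cmod (p\<^sup>2 + B * C))"
    unfolding para prod r2 by (simp add: algebra_simps power_mult_distrib)
  finally have key: "sqrt ((cmod B)\<^sup>2 + (cmod (r - p))\<^sup>2) * sqrt ((cmod B)\<^sup>2 + (cmod (- r - p))\<^sup>2) =
    cmod B * sqrt (2 * (cmod p)\<^sup>2 + (cmod B)\<^sup>2 + (cmod C)\<^sup>2 + 2 * cmod (p\<^sup>2 + B * C))" (is "?L = _ * ?S")
    by (metis real_sqrt_mult real_sqrt_abs abs_norm_cancel)
  have "(cmod B * norm w) * (cmod B * norm z) = (cmod (w $ 1) * cmod (z $ 1)) * ?L"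
    unfolding norm_scaled[OF W(2)] norm_scaled[OF Z(2), unfolded \<open>r' = - r\<close>] by simp
  then have nn: "cmod B * (norm w * norm z) = cmod (w $ 1) * cmod (z $ 1) * ?S"
    using \<open>B \<noteq> 0\<close> unfolding key by (simp add: mult_ac)
  have "cmod (det (transpose (vector [w, z]))) / (norm w * norm z) =
    (cmod B * cmod (det (transpose (vector [w, z])))) / (cmod B * (norm w * norm z))"
    using \<open>B \<noteq> 0\<close> by simp
  also have "\<dots> = 2 * cmod r / ?S"
    unfolding det nn using W(1) Z(1) by simp
  also have "cmod r = sqrt (cmod (p\<^sup>2 + B * C))"
    by (metis r2 norm_ge_zero real_sqrt_abs abs_of_nonneg)
  finally show ?thesis by (simp add: eigenvector_angle_def p_def B_def C_def)
qed

text \<open>The preceding lemma gives uniqueness in the definite description; the nonzero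
  discriminant supplies two distinct eigenvalues and so existence.\<close>

lemma Gam_eq_eigenvector_angle:
  fixes A :: "complex^2^2"
  assumes b: "A $ 1 $ 2 \<noteq> 0"
    and disc: "((A $ 1 $ 1 - A $ 2 $ 2) / 2)\<^sup>2 + A $ 1 $ 2 * A $ 2 $ 1 \<noteq> 0"
  shows "Gam A = eigenvector_angle ((A $ 1 $ 1 - A $ 2 $ 2) / 2) (A $ 1 $ 2) (A $ 2 $ 1)"
proof -
  define p t where "p = (A $ 1 $ 1 - A $ 2 $ 2) / 2" and "t = (A $ 1 $ 1 + A $ 2 $ 2) / 2"
  define r where "r = csqrt (p\<^sup>2 + A $ 1 $ 2 * A $ 2 $ 1)"
  have r: "r\<^sup>2 = p\<^sup>2 + A $ 1 $ 2 * A $ 2 $ 1" by (simp add: r_def)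
  have "r \<noteq> 0" using disc r by (auto simp: p_def)
  have A11: "A $ 1 $ 1 = t + p" "A $ 2 $ 2 = t - p" by (simp_all add: p_def t_def field_simps)
  \<comment> \<open>Used with \<open>k = r\<close> and \<open>k = - r\<close>, so that one
    computation yields both eigenvectors.\<close>
  have eig: "is_eigenvector A (t + k) (vector [A $ 1 $ 2, k - p])" if "k\<^sup>2 = r\<^sup>2" for k
  proof -
    have "k * k = p * p + A $ 1 $ 2 * A $ 2 $ 1" using that r by (simp add: power2_eq_square)
    then show ?thesis
      using b by (auto simp: is_eigenvector_def vec_eq_iff forall_2 matrix_vector_mult_def sum_2 A11 algebra_simps)
  qed
  have ne: "t + r \<noteq> t + (- r)" using \<open>r \<noteq> 0\<close> by (simp add: eq_neg_iff_add_eq_0 flip: mult_2)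
  show ?thesis
    unfolding Gam_def
  proof (rule the_equality)
    show "\<exists>\<mu> \<nu> w z. \<mu> \<noteq> \<nu> \<and> is_eigenvector A \<mu> w \<and> is_eigenvector A \<nu> z \<and>
        eigenvector_angle ((A $ 1 $ 1 - A $ 2 $ 2) / 2) (A $ 1 $ 2) (A $ 2 $ 1) =
        cmod (det (transpose (vector [w, z]))) / (norm w * norm z)"
      using eigenvector_ratio_eq[OF eig[of r] eig[of "- r"] ne b] eig[of r] eig[of "- r"] ne
      by (metis power2_minus)
  qed (use eigenvector_ratio_eq b in blast)
qed

subsection \<open>Dependence on the spectral parameter\<close>

lemma integral_dot_bound:
  fixes f1 f2 g1 g2 :: "real \<Rightarrow> complex"
  assumes "0 \<le> x" "continuous_on {0..x} f1" "continuous_on {0..x} f2"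
    "continuous_on {0..x} g1" "continuous_on {0..x} g2"
    and f: "\<And>t. t \<in> {0..x} \<Longrightarrow> cmod (f1 t) \<le> B \<and> cmod (f2 t) \<le> B"
    and g: "\<And>t. t \<in> {0..x} \<Longrightarrow> cmod (g1 t) + cmod (g2 t) \<le> S"
  shows "cmod (integral {0..x} (\<lambda>t. f1 t * g1 t + f2 t * g2 t)) \<le> B * S * x"
proof -
  have "cmod (f1 t * g1 t + f2 t * g2 t) \<le> B * S" if t: "t \<in> {0..x}" for t
  proof -
    have "B \<ge> 0" using f[OF t] norm_ge_zero[of "f1 t"] by linarith
    have "cmod (f1 t * g1 t + f2 t * g2 t) \<le> cmod (f1 t) * cmod (g1 t) + cmod (f2 t) * cmod (g2 t)"
      by (metis norm_mult norm_triangle_ineq)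
    also have "\<dots> \<le> B * cmod (g1 t) + B * cmod (g2 t)"
      using f[OF t] by (intro add_mono mult_right_mono) auto
    also have "\<dots> = B * (cmod (g1 t) + cmod (g2 t))"
      by (simp add: distrib_left)
    also have "\<dots> \<le> B * S"
      using \<open>B \<ge> 0\<close> g[OF t] by (intro mult_left_mono)
    finally show ?thesis .
  qed
  then have "cmod (integral {0..x} (\<lambda>t. f1 t * g1 t + f2 t * g2 t)) \<le> B * S * (x - 0)"
    using assms(1-5) by (intro integral_bound continuous_intros) auto
  then show ?thesis by simp
qed

text \<open>The columns of the fundamental matrix at a fixed parameter \<open>lam0\<close>, by
  components; they form the basis with which solutions for other parameters are compared.\<close>

locale dirac_fundamental =
  fixes m :: real and q :: "real \<Rightarrow> real" and lam0 :: complex and u1 u2 v1 v2 :: "real \<Rightarrow> complex"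
  assumes u: "dirac_pair m q lam0 u1 u2" and v: "dirac_pair m q lam0 v1 v2"
    and init: "u1 0 = 1" "u2 0 = 0" "v1 0 = 0" "v2 0 = 1"
begin

lemma det_eq_1: "x \<ge> 0 \<Longrightarrow> u1 x * v2 x - u2 x * v1 x = 1"
  using wronskian_identity[OF u v, of x] init by simp

lemma continuous: "continuous_on {c..d} u1" "continuous_on {c..d} u2"
  "continuous_on {c..d} v1" "continuous_on {c..d} v2"
  using u v by (auto simp: dirac_pair_def locally_abs_continuous_imp_continuous_on)

text \<open>The conjugated columns solve the same equation, so their Wronskians with
  \<open>u\<close> and \<open>v\<close> keep their initial values. With determinant 1 these linear
  relations force each column to equal its conjugate, which takes the place of a uniqueness
  theorem.\<close>

lemma real_valued:
  assumes "lam0 \<in> \<real>" "x \<ge> 0"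
  shows "u1 x \<in> \<real>" "u2 x \<in> \<real>" "v1 x \<in> \<real>" "v2 x \<in> \<real>"
proof -
  have [simp]: "cnj lam0 = lam0" using assms(1) by (simp add: Reals_cnj_iff)
  have cu: "dirac_pair m q lam0 (\<lambda>x. cnj (u1 x)) (\<lambda>x. cnj (u2 x))"
    and cv: "dirac_pair m q lam0 (\<lambda>x. cnj (v1 x)) (\<lambda>x. cnj (v2 x))"
    using dirac_pair_cnj[OF u] dirac_pair_cnj[OF v] by simp_all
  have d: "u1 x * v2 x - u2 x * v1 x = 1" using det_eq_1 assms(2) .
  have uu: "u1 x * cnj (u2 x) - u2 x * cnj (u1 x) = 0"
    and vu: "v1 x * cnj (u2 x) - v2 x * cnj (u1 x) = - 1"
    and uv: "u1 x * cnj (v2 x) - u2 x * cnj (v1 x) = 1"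
    and vv: "v1 x * cnj (v2 x) - v2 x * cnj (v1 x) = 0"
    using wronskian_identity[OF u cu assms(2)] wronskian_identity[OF v cu assms(2)]
      wronskian_identity[OF u cv assms(2)] wronskian_identity[OF v cv assms(2)] init by simp_all
  have "cnj (u1 x) = u1 x" using d uu vu by algebra
  moreover have "cnj (u2 x) = u2 x" using d uu vu by algebra
  moreover have "cnj (v1 x) = v1 x" using d uv vv by algebra
  moreover have "cnj (v2 x) = v2 x" using d uv vv by algebra
  ultimately show "u1 x \<in> \<real>" "u2 x \<in> \<real>" "v1 x \<in> \<real>" "v2 x \<in> \<real>"
    by (simp_all add: Reals_cnj_iff)
qed

text \<open>The coefficients of \<open>z\<close> in the basis \<open>u\<close>, \<open>v\<close> are Wronskians.\<close>

lemma variation_of_constants: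
  assumes z: "dirac_pair m q lam z1 z2" and z0: "dirac_pair m q lam0 w1 w2"
    and eq: "z1 0 = w1 0" "z2 0 = w2 0" and "x \<ge> 0"
  defines "U \<equiv> integral {0..x} (\<lambda>t. u1 t * z1 t + u2 t * z2 t)"
    and "V \<equiv> integral {0..x} (\<lambda>t. v1 t * z1 t + v2 t * z2 t)"
  shows "z1 x - w1 x = (lam0 - lam) * (U * v1 x - V * u1 x)"
    and "z2 x - w2 x = (lam0 - lam) * (U * v2 x - V * u2 x)"
proof -
  have d: "u1 x * v2 x - u2 x * v1 x = 1" using det_eq_1 \<open>x \<ge> 0\<close> .
  have "u1 x * z2 x - u2 x * z1 x = w2 0 + (lam0 - lam) * U"
    "v1 x * z2 x - v2 x * z1 x = - w1 0 + (lam0 - lam) * V"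
    "u1 x * w2 x - u2 x * w1 x = w2 0" "v1 x * w2 x - v2 x * w1 x = - w1 0"
    using wronskian_identity[OF u z \<open>x \<ge> 0\<close>] wronskian_identity[OF v z \<open>x \<ge> 0\<close>]
      wronskian_identity[OF u z0 \<open>x \<ge> 0\<close>] wronskian_identity[OF v z0 \<open>x \<ge> 0\<close>] init eq
    by (simp_all add: U_def V_def)
  \<comment> \<open>A linear system for the two differences, with determinant 1; Cramer's rule
    solves it.\<close>
  then have "u1 x * (z2 x - w2 x) - u2 x * (z1 x - w1 x) = (lam0 - lam) * U"
    "v1 x * (z2 x - w2 x) - v2 x * (z1 x - w1 x) = (lam0 - lam) * V"
    by algebra+
  with d show "z1 x - w1 x = (lam0 - lam) * (U * v1 x - V * u1 x)"
    "z2 x - w2 x = (lam0 - lam) * (U * v2 x - V * u2 x)"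
    by algebra+
qed

text \<open>Variation of constants bounds the difference by \<open>cmod (lam - lam0)\<close> times
  the maximum of the perturbed solution. Near \<open>lam0\<close> that maximum can be absorbed,
  which replaces a Gronwall argument.\<close>

lemma perturbation_bound:
  assumes z: "\<And>lam. dirac_pair m q lam (z1 lam) (z2 lam)"
    and init_z: "\<And>lam. z1 lam 0 = z1 lam0 0" "\<And>lam. z2 lam 0 = z2 lam0 0" and "a \<ge> 0"
  obtains C r where "r > 0" and "\<And>lam x. cmod (lam - lam0) < r \<Longrightarrow> x \<in> {0..a} \<Longrightarrow>
    cmod (z1 lam x - z1 lam0 x) + cmod (z2 lam x - z2 lam0 x) \<le> C * cmod (lam - lam0)"
proof -
  have contz: "continuous_on {c..d} (z1 lam)" "continuous_on {c..d} (z2 lam)" for lam c d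
    using z[of lam] by (auto simp: dirac_pair_def locally_abs_continuous_imp_continuous_on)
  have "continuous_on {0..a} (\<lambda>x. cmod (u1 x) + cmod (u2 x) + (cmod (v1 x) + cmod (v2 x)))"
    by (intro continuous_intros continuous)
  from continuous_on_Icc_bounded[OF this] obtain B where "B > 0" and B0: "\<And>x. x \<in> {0..a} \<Longrightarrow>
      norm (cmod (u1 x) + cmod (u2 x) + (cmod (v1 x) + cmod (v2 x))) \<le> B" by blast
  have B: "cmod (u1 x) \<le> B \<and> cmod (u2 x) \<le> B" "cmod (v1 x) \<le> B \<and> cmod (v2 x) \<le> B" if "x \<in> {0..a}" for x
  proof -
    note norm_ge_zero[of "u1 x"] norm_ge_zero[of "u2 x"] norm_ge_zero[of "v1 x"] norm_ge_zero[of "v2 x"]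
    then show "cmod (u1 x) \<le> B \<and> cmod (u2 x) \<le> B" "cmod (v1 x) \<le> B \<and> cmod (v2 x) \<le> B"
      using B0[OF that] unfolding real_norm_def by linarith+
  qed
  have "continuous_on {0..a} (\<lambda>x. cmod (z1 lam0 x) + cmod (z2 lam0 x))"
    by (intro continuous_intros contz)
  from continuous_on_Icc_bounded[OF this] obtain S0
    where S0: "\<And>x. x \<in> {0..a} \<Longrightarrow> norm (cmod (z1 lam0 x) + cmod (z2 lam0 x)) \<le> S0"
    by blast
  note S0 = S0[unfolded real_norm_def, THEN abs_le_D1]
  \<comment> \<open>Two components, each with two products of an integral bounded by
    \<open>B * S * a\<close> and a function bounded by \<open>B\<close>.\<close>
  define K where "K = 4 * B * B * a"
  have "K \<ge> 0" using \<open>B > 0\<close> \<open>a \<ge> 0\<close> by (simp add: K_def)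
  have diff: "cmod (z1 lam x - z1 lam0 x) + cmod (z2 lam x - z2 lam0 x) \<le> K * cmod (lam - lam0) * S"
    if x: "x \<in> {0..a}" and S: "\<And>t. t \<in> {0..a} \<Longrightarrow> cmod (z1 lam t) + cmod (z2 lam t) \<le> S" for lam x S
  proof -
    define U where "U = integral {0..x} (\<lambda>t. u1 t * z1 lam t + u2 t * z2 lam t)"
    define V where "V = integral {0..x} (\<lambda>t. v1 t * z1 lam t + v2 t * z2 lam t)"
    have "S \<ge> 0" using S[OF x] by (smt (verit) norm_ge_zero)
    have "cmod U \<le> B * S * x" "cmod V \<le> B * S * x"
      unfolding U_def V_def using x B S
      by (intro integral_dot_bound continuous contz; auto)+
    moreover have "B * S * x \<le> B * S * a"
      using x \<open>B > 0\<close> \<open>S \<ge> 0\<close> by (intro mult_left_mono) auto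
    ultimately have UV: "cmod U \<le> B * S * a" "cmod V \<le> B * S * a" by linarith+
    have comb: "cmod ((lam0 - lam) * (U * s - V * t)) \<le> cmod (lam - lam0) * (2 * B * B * a * S)"
      if "cmod s \<le> B" "cmod t \<le> B" for s t
    proof -
      have "cmod (U * s - V * t) \<le> cmod U * cmod s + cmod V * cmod t"
        by (metis norm_mult norm_triangle_ineq4)
      also have "\<dots> \<le> B * S * a * B + B * S * a * B"
        using UV that \<open>B > 0\<close> \<open>S \<ge> 0\<close> \<open>a \<ge> 0\<close> by (intro add_mono mult_mono) auto
      also have "\<dots> = 2 * B * B * a * S" by simp
      finally show ?thesis by (simp add: norm_mult norm_minus_commute mult_left_mono)
    qed
    have "x \<ge> 0" using x by simp
    note voc = variation_of_constants[OF z[of lam] z[of lam0] init_z[of lam] \<open>x \<ge> 0\<close>, folded U_def V_def]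
    have "cmod (z1 lam x - z1 lam0 x) + cmod (z2 lam x - z2 lam0 x) \<le>
      cmod (lam - lam0) * (2 * B * B * a * S) + cmod (lam - lam0) * (2 * B * B * a * S)"
      unfolding voc using B[OF x] by (intro add_mono comb) auto
    then show ?thesis by (simp add: K_def algebra_simps)
  qed
  \<comment> \<open>The radius ensures \<open>K * cmod (lam - lam0) \<le> 1 / 2\<close>;
    \<open>K + 1\<close> keeps it well defined for \<open>K = 0\<close>.\<close>
  have "cmod (z1 lam x - z1 lam0 x) + cmod (z2 lam x - z2 lam0 x) \<le> (K * (2 * S0)) * cmod (lam - lam0)"
    if lam: "cmod (lam - lam0) < 1 / (2 * (K + 1))" and x: "x \<in> {0..a}" for lam x
  proof -
    have "continuous_on {0..a} (\<lambda>x. cmod (z1 lam x) + cmod (z2 lam x))"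
      by (intro continuous_intros contz)
    then obtain y where y: "y \<in> {0..a}"
      "\<And>t. t \<in> {0..a} \<Longrightarrow> cmod (z1 lam t) + cmod (z2 lam t) \<le> cmod (z1 lam y) + cmod (z2 lam y)"
      using continuous_attains_sup[of "{0..a}" "\<lambda>x. cmod (z1 lam x) + cmod (z2 lam x)"] x by auto
    \<comment> \<open>\<open>S\<close> is the attained maximum. The estimate at the maximum point
      gives \<open>S \<le> S0 + S / 2\<close>, hence a bound independent of
      \<open>lam\<close>.\<close>
    define S where "S = cmod (z1 lam y) + cmod (z2 lam y)"
    have "S \<ge> 0" by (simp add: S_def)
    have "cmod (z1 lam y) \<le> cmod (z1 lam0 y) + cmod (z1 lam y - z1 lam0 y)"
      "cmod (z2 lam y) \<le> cmod (z2 lam0 y) + cmod (z2 lam y - z2 lam0 y)"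
      by (metis add.commute diff_add_cancel norm_triangle_ineq)+
    then have "S \<le> S0 + (cmod (z1 lam y - z1 lam0 y) + cmod (z2 lam y - z2 lam0 y))"
      using S0[OF y(1)] unfolding S_def by linarith
    also have "\<dots> \<le> S0 + K * cmod (lam - lam0) * S"
      using diff[OF y(1), of lam S] y(2) by (simp add: S_def)
    also have "K * cmod (lam - lam0) * S \<le> 1 / 2 * S"
    proof (intro mult_right_mono \<open>S \<ge> 0\<close>)
      have "cmod (lam - lam0) * (2 * (K + 1)) < 1"
        using lam \<open>K \<ge> 0\<close> by (simp add: pos_less_divide_eq)
      then show "K * cmod (lam - lam0) \<le> 1 / 2"
        by (simp add: algebra_simps) (smt (verit) norm_ge_zero)
    qed
    finally have "S \<le> 2 * S0" by simp
    have "cmod (z1 lam x - z1 lam0 x) + cmod (z2 lam x - z2 lam0 x) \<le> K * cmod (lam - lam0) * (2 * S0)"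
      using y(2) \<open>S \<le> 2 * S0\<close> by (intro diff x) (auto simp: S_def intro: order_trans)
    then show ?thesis by (simp add: algebra_simps)
  qed
  moreover have "1 / (2 * (K + 1)) > 0" using \<open>K \<ge> 0\<close> by simp
  ultimately show ?thesis by (rule that[rotated])
qed

lemma integral_dot_tendsto:
  assumes z: "\<And>lam. dirac_pair m q lam (z1 lam) (z2 lam)"
    and init_z: "\<And>lam. z1 lam 0 = z1 lam0 0" "\<And>lam. z2 lam 0 = z2 lam0 0" and "a \<ge> 0"
    and y: "continuous_on {0..a} y1" "continuous_on {0..a} y2"
  shows "((\<lambda>lam. integral {0..a} (\<lambda>t. y1 t * z1 lam t + y2 t * z2 lam t)) \<longlongrightarrow>
    integral {0..a} (\<lambda>t. y1 t * z1 lam0 t + y2 t * z2 lam0 t)) (at lam0)"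
    (is "(?F \<longlongrightarrow> _) _")
proof -
  have contz: "continuous_on {0..a} (z1 lam)" "continuous_on {0..a} (z2 lam)" for lam
    using z[of lam] by (auto simp: dirac_pair_def locally_abs_continuous_imp_continuous_on)
  obtain C r where "r > 0" and C: "\<And>lam x. cmod (lam - lam0) < r \<Longrightarrow> x \<in> {0..a} \<Longrightarrow>
      cmod (z1 lam x - z1 lam0 x) + cmod (z2 lam x - z2 lam0 x) \<le> C * cmod (lam - lam0)"
    using perturbation_bound[of z1 z2 a, OF z init_z \<open>a \<ge> 0\<close>] by metis
  have "continuous_on {0..a} (\<lambda>x. cmod (y1 x) + cmod (y2 x))"
    by (intro continuous_intros y)
  from continuous_on_Icc_bounded[OF this] obtain B
    where B: "\<And>x. x \<in> {0..a} \<Longrightarrow> norm (cmod (y1 x) + cmod (y2 x)) \<le> B"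
    by blast
  note B = B[unfolded real_norm_def, THEN abs_le_D1]
  have bound: "cmod (?F lam - ?F lam0) \<le> B * a * C * cmod (lam - lam0)" if "cmod (lam - lam0) < r" for lam
  proof -
    have "?F lam - ?F lam0 =
        integral {0..a} (\<lambda>t. (y1 t * z1 lam t + y2 t * z2 lam t) - (y1 t * z1 lam0 t + y2 t * z2 lam0 t))"
      by (intro integral_diff[symmetric] integrable_continuous_interval continuous_intros contz y)
    also have "\<dots> = integral {0..a} (\<lambda>t. y1 t * (z1 lam t - z1 lam0 t) + y2 t * (z2 lam t - z2 lam0 t))"
      by (simp add: algebra_simps)
    also have "cmod \<dots> \<le> B * (C * cmod (lam - lam0)) * a"
    proof (intro integral_dot_bound continuous_intros contz y \<open>a \<ge> 0\<close>)
      fix t assume t: "t \<in> {0..a}"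
      show "cmod (y1 t) \<le> B \<and> cmod (y2 t) \<le> B"
        using B[OF t] norm_ge_zero[of "y1 t"] norm_ge_zero[of "y2 t"] by linarith
      show "cmod (z1 lam t - z1 lam0 t) + cmod (z2 lam t - z2 lam0 t) \<le> C * cmod (lam - lam0)"
        using C[OF that t] .
    qed
    finally show ?thesis by (simp add: algebra_simps)
  qed
  have "((\<lambda>lam. B * a * C * cmod (lam - lam0)) \<longlongrightarrow> B * a * C * cmod (lam0 - lam0)) (at lam0)"
    by (intro tendsto_intros)
  then have lim: "((\<lambda>lam. B * a * C * cmod (lam - lam0)) \<longlongrightarrow> 0) (at lam0)"
    by simp
  have "eventually (\<lambda>lam. cmod (?F lam - ?F lam0) \<le> B * a * C * cmod (lam - lam0)) (at lam0)"
    unfolding eventually_at dist_norm using \<open>r > 0\<close> bound by blast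
  from Lim_null_comparison[OF this lim] have "((\<lambda>lam. ?F lam - ?F lam0) \<longlongrightarrow> 0) (at lam0)" .
  then show ?thesis by (simp add: LIM_zero_iff)
qed

end

subsection \<open>The limit\<close>

lemma integral_pos_continuous:
  fixes f :: "real \<Rightarrow> real"
  assumes "continuous_on {a..b} f" "a < b" "\<And>x. x \<in> {a..b} \<Longrightarrow> f x \<ge> 0" "c \<in> {a..b}" "f c \<noteq> 0"
  shows "integral {a..b} f > 0"
proof -
  have "integral {a..b} f \<noteq> 0"
    using integral_eq_0_iff[of a b f] assms by blast
  moreover have "integral {a..b} f \<ge> 0"
    using assms(1,3) by (intro integral_nonneg integrable_continuous_interval)
  ultimately show ?thesis by simp
qed

text \<open>Linear independence at the left end point keeps |g - t f|^2 nonzero there for every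
  \<open>t\<close>, so by continuity its integral is positive. The columns of the fundamental matrix
  are independent at 0.\<close>

lemma strict_Cauchy_Schwarz_integral:
  fixes f1 f2 g1 g2 :: "real \<Rightarrow> real"
  assumes cont: "continuous_on {a..b} f1" "continuous_on {a..b} f2"
    "continuous_on {a..b} g1" "continuous_on {a..b} g2" and "a < b"
    and indep: "f1 a * g2 a - f2 a * g1 a \<noteq> 0"
  shows "integral {a..b} (\<lambda>x. f1 x * f1 x + f2 x * f2 x) > 0" (is "?F > 0")
    and "(integral {a..b} (\<lambda>x. f1 x * g1 x + f2 x * g2 x))\<^sup>2 <
      integral {a..b} (\<lambda>x. f1 x * f1 x + f2 x * f2 x) *
      integral {a..b} (\<lambda>x. g1 x * g1 x + g2 x * g2 x)" (is "?H\<^sup>2 < _ * ?G")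
proof -
  have F: "f1 a * f1 a + f2 a * f2 a \<noteq> 0" using indep by auto
  show "?F > 0"
    using \<open>a < b\<close> F by (intro integral_pos_continuous[where c = a] continuous_intros cont) auto
  \<comment> \<open>The minimiser of the quadratic
    \<open>?G - 2 * t * ?H + t * t * ?F\<close>.\<close>
  define t where "t = ?H / ?F"
  let ?h = "\<lambda>x. (g1 x - t * f1 x) * (g1 x - t * f1 x) + (g2 x - t * f2 x) * (g2 x - t * f2 x)"
  have "?h a \<noteq> 0"
  proof
    assume "?h a = 0"
    then have "g1 a = t * f1 a" "g2 a = t * f2 a" by auto
    then show False using indep by simp
  qed
  then have pos: "integral {a..b} ?h > 0"
    using \<open>a < b\<close> by (intro integral_pos_continuous[where c = a] continuous_intros cont) auto
  have "?h = (\<lambda>x. (g1 x * g1 x + g2 x * g2 x) - (2 * t) * (f1 x * g1 x + f2 x * g2 x) +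
      (t * t) * (f1 x * f1 x + f2 x * f2 x))"
    by (rule ext) algebra
  then have "integral {a..b} ?h = integral {a..b} (\<lambda>x. (g1 x * g1 x + g2 x * g2 x) -
      (2 * t) * (f1 x * g1 x + f2 x * g2 x) + (t * t) * (f1 x * f1 x + f2 x * f2 x))"
    by simp
  also have "\<dots> = integral {a..b} (\<lambda>x. (g1 x * g1 x + g2 x * g2 x) - (2 * t) * (f1 x * g1 x + f2 x * g2 x))
      + integral {a..b} (\<lambda>x. (t * t) * (f1 x * f1 x + f2 x * f2 x))"
    by (intro integral_add integrable_continuous_interval continuous_intros cont)
  also have "integral {a..b} (\<lambda>x. (g1 x * g1 x + g2 x * g2 x) - (2 * t) * (f1 x * g1 x + f2 x * g2 x)) =
      ?G - integral {a..b} (\<lambda>x. (2 * t) * (f1 x * g1 x + f2 x * g2 x))"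
    by (intro integral_diff integrable_continuous_interval continuous_intros cont)
  also have "integral {a..b} (\<lambda>x. (2 * t) * (f1 x * g1 x + f2 x * g2 x)) = 2 * t * ?H"
    by (rule integral_mult_right)
  also have "integral {a..b} (\<lambda>x. (t * t) * (f1 x * f1 x + f2 x * f2 x)) = t * t * ?F"
    by (rule integral_mult_right)
  finally have "?G - 2 * t * ?H + t * t * ?F > 0" using pos by simp
  moreover have "t * ?F = ?H" using \<open>?F > 0\<close> by (simp add: t_def)
  ultimately have "?G - t * ?H > 0" by (simp add: mult.assoc)
  then have "?F * (?G - t * ?H) > 0" using \<open>?F > 0\<close> by (intro mult_pos_pos)
  moreover have "?F * (?G - t * ?H) = ?F * ?G - ?H\<^sup>2"
    using \<open>t * ?F = ?H\<close> by (simp add: algebra_simps power2_eq_square)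
  ultimately show "?H\<^sup>2 < ?F * ?G" by simp
qed

lemma integral_dot_of_real:
  fixes f1 f2 g1 g2 :: "real \<Rightarrow> complex"
  assumes "continuous_on {a..b} f1" "continuous_on {a..b} f2"
    "continuous_on {a..b} g1" "continuous_on {a..b} g2"
    and "\<And>x. x \<in> {a..b} \<Longrightarrow> f1 x \<in> \<real> \<and> f2 x \<in> \<real> \<and> g1 x \<in> \<real> \<and> g2 x \<in> \<real>"
  shows "integral {a..b} (\<lambda>x. f1 x * g1 x + f2 x * g2 x) =
    of_real (integral {a..b} (\<lambda>x. Re (f1 x) * Re (g1 x) + Re (f2 x) * Re (g2 x)))"
proof -
  have "((\<lambda>x. Re (f1 x) * Re (g1 x) + Re (f2 x) * Re (g2 x)) has_integral
      integral {a..b} (\<lambda>x. Re (f1 x) * Re (g1 x) + Re (f2 x) * Re (g2 x))) {a..b}"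
    by (intro integrable_integral integrable_continuous_interval continuous_intros assms)
  from has_integral_of_real[OF this] have "((\<lambda>x. f1 x * g1 x + f2 x * g2 x) has_integral
      of_real (integral {a..b} (\<lambda>x. Re (f1 x) * Re (g1 x) + Re (f2 x) * Re (g2 x)))) {a..b}"
    by (rule has_integral_eq[rotated]) (use assms(5) in \<open>auto simp: of_real_Re\<close>)
  then show ?thesis by (rule integral_unique)
qed

lemma eigenvector_angle_tendsto:
  assumes "(p \<longlongrightarrow> p0) F" "(b \<longlongrightarrow> b0) F" "(c \<longlongrightarrow> c0) F" "b0 \<noteq> 0"
  shows "((\<lambda>x. eigenvector_angle (p x) (b x) (c x)) \<longlongrightarrow> eigenvector_angle p0 b0 c0) F"
proof -
  have "2 * (cmod p0)\<^sup>2 + (cmod b0)\<^sup>2 + (cmod c0)\<^sup>2 + 2 * cmod (p0\<^sup>2 + b0 * c0) > 0"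
    using assms(4) by (intro add_pos_nonneg add_nonneg_pos) auto
  then show ?thesis
    unfolding eigenvector_angle_def by (intro tendsto_intros assms) simp
qed

text \<open>The integrals have complex type. Their reality is part of the conclusion, so taking
  \<open>Re\<close> in \<open>L\<close> loses nothing. The filter \<open>at\<close> is that of
  punctured complex neighbourhoods.\<close>

theorem theorem5:
  fixes m a :: real
    and q :: "real \<Rightarrow> real"
    and \<Phi> :: "real \<Rightarrow> complex \<Rightarrow> complex^2^2"
    and lam0 :: real
    and s :: complex
  assumes "m \<ge> 0"
    and "a > 0"
    and "locally_integrable q"
    and "\<forall>x. q (x + a) = q x"
    and "\<forall>lam. dirac_matrix_solution m q lam (\<lambda>x. \<Phi> x lam)"
    and "\<forall>lam. \<Phi> 0 lam = mat 1"
    and "s \<in> {-1, 1}"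
    and "monodromy a \<Phi> (of_real lam0) = mat s"
  shows "let J1 = I1 a \<Phi> (of_real lam0);
             J2 = I2 a \<Phi> (of_real lam0);
             J3 = I3 a \<Phi> (of_real lam0);
             L = 2 * (sqrt (Re J2 * Re J3 - (Re J1)\<^sup>2) / (Re J2 + Re J3))
         in J1 \<in> \<real> \<and> J2 \<in> \<real> \<and> J3 \<in> \<real> \<and>
            ((\<lambda>lam. Gam (monodromy a \<Phi> lam)) \<longlongrightarrow> L) (at (of_real lam0)) \<and> L > 0"
proof -
  define l0 :: complex where "l0 = of_real lam0"
  \<comment> \<open>\<open>i\<close> is the component and \<open>j\<close> the column:
    \<open>j = 1\<close> gives u, \<open>j = 2\<close> gives v.\<close>
  define y :: "2 \<Rightarrow> 2 \<Rightarrow> complex \<Rightarrow> real \<Rightarrow> complex" where "y = (\<lambda>i j lam x. \<Phi> x lam $ i $ j)"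
  have pair: "dirac_pair m q lam (y 1 j lam) (y 2 j lam)" for lam j
    unfolding y_def by (intro dirac_pair_column) (use assms(5) in blast)
  have y0: "y 1 1 lam 0 = 1" "y 2 1 lam 0 = 0" "y 1 2 lam 0 = 0" "y 2 2 lam 0 = 1" for lam
    using assms(6) by (simp_all add: y_def mat_def)
  have ya: "y 1 1 l0 a = s" "y 2 1 l0 a = 0" "y 1 2 l0 a = 0" "y 2 2 l0 a = s"
    using assms(8) by (simp_all add: y_def mat_def monodromy_def l0_def)
  have "s * s = 1" "s \<noteq> 0" using assms(7) by auto
  interpret dirac_fundamental m q l0 "y 1 1 l0" "y 2 1 l0" "y 1 2 l0" "y 2 2 l0"
    by unfold_locales (intro pair y0)+
  have "l0 \<in> \<real>" by (simp add: l0_def)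
  \<comment> \<open>Column \<open>i\<close> stays at \<open>l0\<close> and only column
    \<open>j\<close> varies with \<open>lam\<close>; at \<open>l0\<close> these are the integrals
    \<open>I1\<close>, \<open>I2\<close>, \<open>I3\<close>.\<close>
  define h :: "2 \<Rightarrow> 2 \<Rightarrow> complex \<Rightarrow> complex" where
    "h i j lam = integral {0..a} (\<lambda>t. y 1 i l0 t * y 1 j lam t + y 2 i l0 t * y 2 j lam t)" for i j lam
  have cont: "continuous_on {0..a} (y i j l0)" for i j
    using continuous exhaust_2[of i] exhaust_2[of j] by auto
  have real: "y i j l0 x \<in> \<real>" if "x \<in> {0..a}" for i j x
    using real_valued[OF \<open>l0 \<in> \<real>\<close>, of x] that exhaust_2[of i] exhaust_2[of j] by auto
  have h_tendsto: "(h i j \<longlongrightarrow> h i j l0) (at l0)" for i j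
  proof -
    have "y 1 j lam 0 = y 1 j l0 0" "y 2 j lam 0 = y 2 j l0 0" for lam
      using y0 exhaust_2[of j] by auto
    then show ?thesis
      unfolding h_def using \<open>a > 0\<close> by (intro integral_dot_tendsto pair cont) auto
  qed
  define H where "H i j = integral {0..a} (\<lambda>x. Re (y 1 i l0 x) * Re (y 1 j l0 x) + Re (y 2 i l0 x) * Re (y 2 j l0 x))"
    for i j :: 2
  have hH: "h i j l0 = of_real (H i j)" for i j
    unfolding h_def H_def by (intro integral_dot_of_real cont) (simp add: real)
  have J: "I1 a \<Phi> l0 = of_real (H 1 2)" "I2 a \<Phi> l0 = of_real (H 2 2)" "I3 a \<Phi> l0 = of_real (H 1 1)"
    unfolding hH[symmetric] by (simp_all add: I1_def I2_def I3_def h_def y_def Let_def column_def power2_eq_square)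
  have "H 2 1 = H 1 2" by (simp add: H_def mult.commute)
  have indep: "Re (y 1 i l0 0) * Re (y 2 j l0 0) - Re (y 2 i l0 0) * Re (y 1 j l0 0) \<noteq> 0"
    if "i \<noteq> j" for i j
    using that y0 exhaust_2[of i] exhaust_2[of j] by auto
  have CSij: "H i i > 0" "(H i j)\<^sup>2 < H i i * H j j" if "i \<noteq> j" for i j
  proof -
    have "continuous_on {0..a} (\<lambda>x. Re (y k l l0 x))" for k l
      by (intro continuous_intros cont)
    from strict_Cauchy_Schwarz_integral[where ?f1.0 = "\<lambda>x. Re (y 1 i l0 x)" and ?f2.0 = "\<lambda>x. Re (y 2 i l0 x)"
        and ?g1.0 = "\<lambda>x. Re (y 1 j l0 x)" and ?g2.0 = "\<lambda>x. Re (y 2 j l0 x)",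
        OF this this this this \<open>a > 0\<close> indep[OF that]]
    show "H i i > 0" "(H i j)\<^sup>2 < H i i * H j j"
      unfolding H_def .
  qed
  have "H 1 1 > 0" "H 2 2 > 0" and CS: "(H 1 2)\<^sup>2 < H 1 1 * H 2 2"
    using CSij[of 1 2] CSij[of 2 1] by simp_all
  define L where "L = 2 * (sqrt (H 2 2 * H 1 1 - (H 1 2)\<^sup>2) / (H 2 2 + H 1 1))"
  have "L > 0" using \<open>H 1 1 > 0\<close> \<open>H 2 2 > 0\<close> CS by (simp add: L_def mult.commute)

  \<comment> \<open>The matrix N(lam) has rows \<open>(h 2 1 lam, h 2 2 lam)\<close> and
    \<open>(- h 1 1 lam, - h 1 2 lam)\<close>; \<open>p\<close> is half the difference of its
    diagonal entries.\<close>
  define p where "p lam = (h 2 1 lam + h 1 2 lam) / 2" for lam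
  have p_tendsto: "(p \<longlongrightarrow> of_real (H 1 2)) (at l0)"
  proof -
    have "(p \<longlongrightarrow> (h 2 1 l0 + h 1 2 l0) / 2) (at l0)"
      unfolding p_def by (intro tendsto_intros h_tendsto) simp
    then show ?thesis by (simp add: hH \<open>H 2 1 = H 1 2\<close>)
  qed
  note b_tendsto = h_tendsto[of 2 2, unfolded hH]
  note c_tendsto = tendsto_minus[OF h_tendsto[of 1 1, unfolded hH]]
  have disc_tendsto: "((\<lambda>lam. (p lam)\<^sup>2 + h 2 2 lam * - h 1 1 lam) \<longlongrightarrow>
      (of_real (H 1 2))\<^sup>2 + of_real (H 2 2) * - of_real (H 1 1)) (at l0)"
    by (intro tendsto_intros p_tendsto b_tendsto c_tendsto)
  have disc: "(of_real (H 1 2))\<^sup>2 + of_real (H 2 2) * - of_real (H 1 1) = (of_real ((H 1 2)\<^sup>2 - H 1 1 * H 2 2) :: complex)"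
    by simp
  have disc_norm: "cmod ((of_real (H 1 2))\<^sup>2 + of_real (H 2 2) * - of_real (H 1 1)) = H 2 2 * H 1 1 - (H 1 2)\<^sup>2"
    unfolding disc norm_of_real using CS by simp
  have angle_limit: "eigenvector_angle (of_real (H 1 2)) (of_real (H 2 2)) (- of_real (H 1 1)) = L"
  proof -
    \<comment> \<open>The discriminant is negative at the limit, so its modulus cancels the term
      with \<open>H 1 2\<close> and leaves a perfect square under the root.\<close>
    have "2 * (H 1 2)\<^sup>2 + (H 2 2)\<^sup>2 + (H 1 1)\<^sup>2 + 2 * (H 2 2 * H 1 1 - (H 1 2)\<^sup>2) = (H 2 2 + H 1 1)\<^sup>2"
      by (simp add: power2_eq_square algebra_simps)
    then show ?thesis
      using \<open>H 1 1 > 0\<close> \<open>H 2 2 > 0\<close> unfolding eigenvector_angle_def disc_norm L_def by simp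
  qed
  have limit: "((\<lambda>lam. eigenvector_angle (p lam) (h 2 2 lam) (- h 1 1 lam)) \<longlongrightarrow> L) (at l0)"
    unfolding angle_limit[symmetric] using \<open>H 2 2 > 0\<close>
    by (intro eigenvector_angle_tendsto p_tendsto b_tendsto c_tendsto) simp

  \<comment> \<open>The exact formula for the monodromy matrix and its angle near the limit
    point\<close>
  have Gam_eq: "Gam (monodromy a \<Phi> lam) = eigenvector_angle (p lam) (h 2 2 lam) (- h 1 1 lam)"
    if "lam \<noteq> l0" and b: "h 2 2 lam \<noteq> 0" and D: "(p lam)\<^sup>2 + h 2 2 lam * - h 1 1 lam \<noteq> 0" for lam
  proof -
    define A where "A = monodromy a \<Phi> lam"
    define k where "k = s * (lam - l0)"
    have "k \<noteq> 0" using \<open>s \<noteq> 0\<close> \<open>lam \<noteq> l0\<close> by (simp add: k_def)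
    have A: "y i j lam a = A $ i $ j" for i j by (simp add: A_def monodromy_def y_def)
    \<comment> \<open>The columns at \<open>l0\<close> take the values \<open>(s, 0)\<close> and
      \<open>(0, s)\<close> at \<open>a\<close>, so each Wronskian with a column at
      \<open>lam\<close> isolates one entry of \<open>A\<close> up to sign.\<close>
    have "s * A $ 2 $ 1 = (l0 - lam) * h 1 1 lam" "s * A $ 2 $ 2 = 1 + (l0 - lam) * h 1 2 lam"
      "- s * A $ 1 $ 1 = - 1 + (l0 - lam) * h 2 1 lam" "- s * A $ 1 $ 2 = (l0 - lam) * h 2 2 lam"
      using wronskian_identity[OF pair[of l0 1] pair[of lam 1], of a]
        wronskian_identity[OF pair[of l0 1] pair[of lam 2], of a]
        wronskian_identity[OF pair[of l0 2] pair[of lam 1], of a]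
        wronskian_identity[OF pair[of l0 2] pair[of lam 2], of a] \<open>a > 0\<close> y0 ya
      by (simp_all add: h_def A)
    then have "A $ 2 $ 1 = k * - h 1 1 lam" "A $ 1 $ 2 = k * h 2 2 lam"
      "A $ 1 $ 1 - A $ 2 $ 2 = k * (h 2 1 lam + h 1 2 lam)"
      unfolding k_def using \<open>s * s = 1\<close> by algebra+
    then have ent: "A $ 2 $ 1 = k * - h 1 1 lam" "A $ 1 $ 2 = k * h 2 2 lam"
      "(A $ 1 $ 1 - A $ 2 $ 2) / 2 = k * p lam" by (simp_all add: p_def)
    have "(k * p lam)\<^sup>2 + k * h 2 2 lam * (k * - h 1 1 lam) = k\<^sup>2 * ((p lam)\<^sup>2 + h 2 2 lam * - h 1 1 lam)"
      by algebra
    then have "(k * p lam)\<^sup>2 + k * h 2 2 lam * (k * - h 1 1 lam) \<noteq> 0"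
      using D \<open>k \<noteq> 0\<close> by simp
    then have "Gam A = eigenvector_angle (k * p lam) (k * h 2 2 lam) (k * - h 1 1 lam)"
      using Gam_eq_eigenvector_angle[of A] b \<open>k \<noteq> 0\<close> unfolding ent by simp
    then show ?thesis
      using eigenvector_angle_scale[OF \<open>k \<noteq> 0\<close>] by (simp only: A_def)
  qed
  \<comment> \<open>Both limits are nonzero, by \<open>H 2 2 > 0\<close> and the strict
    Cauchy-Schwarz inequality, so the exact formula for \<open>Gam\<close> holds in a punctured
    neighbourhood.\<close>
  have "eventually (\<lambda>lam. h 2 2 lam \<noteq> 0) (at l0)"
    using b_tendsto \<open>H 2 2 > 0\<close> by (intro tendsto_imp_eventually_ne) auto
  moreover have "eventually (\<lambda>lam. (p lam)\<^sup>2 + h 2 2 lam * - h 1 1 lam \<noteq> 0) (at l0)"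
    using disc_tendsto by (rule tendsto_imp_eventually_ne) (unfold disc of_real_eq_0_iff, use CS in simp)
  moreover have "eventually (\<lambda>lam. lam \<noteq> l0) (at l0)"
    by (rule eventually_neq_at_within)
  ultimately have "eventually (\<lambda>lam. eigenvector_angle (p lam) (h 2 2 lam) (- h 1 1 lam) =
      Gam (monodromy a \<Phi> lam)) (at l0)"
    by eventually_elim (rule Gam_eq[symmetric])
  with limit have "((\<lambda>lam. Gam (monodromy a \<Phi> lam)) \<longlongrightarrow> L) (at l0)"
    by (rule Lim_transform_eventually)
  with \<open>L > 0\<close> show ?thesis
    unfolding l0_def[symmetric] J Let_def L_def by simp
qed

end
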